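(* Let $A$ and $B$ be nearrings and let $E(\psi,[-,-],\alpha,\beta,\langle -,-\rangle)$ be a quintuple of functions $$\psi:B\to \mathrm{Aut}(A,+),\ b\mapsto\psi_b;\quad [-,-]:B^2\to A;\quad \alpha:B\to \mathrm{Map}(A^2,A),\ b\mapsto \alpha_b;\quad \beta:B^2\to \mathrm{Map}(A,A),\ (b_1,b_2)\mapsto\beta_{b_1,b_2};\quad \langle -,-\rangle:B^2\to A$$ such that for all $b,b_1,b_2\in B$ and $a,a_1,a_2\in A$ the following initial conditions hold: $[b,0]=[0,b]=0$; $\alpha_b(a_1+a_2,a)=\alpha_b(a_1,a)+\alpha_b(a_2,a)$; $\alpha_0(a_1,a_2)=a_1a_2$; $\beta_{0,b}=0$ (the zero map) and $\beta_{b_1,b_2}(0)=0$; $\langle 0,b\rangle=0$. Let $A\boxtimes B$ be the set $A\times B$ with the operations $$(a_1,b_1)+(a_2,b_2)=(a_1+\psi_{b_1}(a_2)+[b_1,b_2],\,b_1+b_2),$$ $$(a_1,b_1)(a_2,b_2)=(\alpha_{b_2}(a_1,a_2)+\beta_{b_1,b_2}(a_2)+\langle b_1,b_2\rangle,\,b_1b_2).$$ Then $(A\boxtimes B,+,\cdot)$ is a nearring if and only if the following six conditions hold for all $a_1,a_2,a_3\in A$ and $b_1,b_2,b_3\in B$: $(G_1)$ $[b_1,b_2]+[b_1+b_2,b_3]=\psi_{b_1}([b_2,b_3])+[b_1,b_2+b_3]$; $(G_2)$ $\psi_{b_1}\circ\psi_{b_2}=\Phi_{[b_1,b_2]}\circ\psi_{b_1+b_2}$,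 where $\Phi_c(g)=c+g-c$ for $c,g\in A$; $(A_1)$ $\alpha_{b_3}(\beta_{b_1,b_2}(a_2)+\langle b_1,b_2\rangle,a_3)+\beta_{b_1b_2,b_3}(a_3)+\langle b_1b_2,b_3\rangle=\beta_{b_1,b_2b_3}\big(\alpha_{b_3}(a_2,a_3)+\beta_{b_2,b_3}(a_3)+\langle b_2,b_3\rangle\big)+\langle b_1,b_2b_3\rangle$; $(A_2)$ $\alpha_{b_3}(\alpha_{b_2}(a_1,a_2),a_3)=\alpha_{b_2b_3}\big(a_1,\alpha_{b_3}(a_2,a_3)+\beta_{b_2,b_3}(a_3)+\langle b_2,b_3\rangle\big)$; $(D_1)$ $\alpha_{b_3}([b_1,b_2],a_3)+\beta_{b_1+b_2,b_3}(a_3)+\langle b_1+b_2,b_3\rangle=\beta_{b_1,b_3}(a_3)+\langle b_1,b_3\rangle+\psi_{b_1b_3}(\beta_{b_2,b_3}(a_3))+\psi_{b_1b_3}(\langle b_2,b_3\rangle)+[b_1b_3,b_2b_3]$; $(D_2)$ $\alpha_{b_3}(\psi_{b_1}(a_2),a_3)+\beta_{b_1,b_3}(a_3)+\langle b_1,b_3\rangle=\beta_{b_1,b_3}(a_3)+\langle b_1,b_3\rangle+\psi_{b_1b_3}(\alpha_{b_3}(a_2,a_3))$. Moreover, if $A\boxtimes B$ is a nearring, then $\xi:A\to A\boxtimes B$, $\xi(a)=(a,0)$, is an injective nearring homomorphism with $A\cong\xi(A)=(A,0):=\{(a,0)\mid a\in A\}$ an ideal of $A\boxtimes B$, and $\eta:A\boxtimes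 B\to B$, $\eta(a,b)=b$, is a surjective nearring homomorphism with $\ker(\eta)=(A,0)$; hence $A\boxtimes B$ is an extension of $A$ by $B$.
   Context: A nearring is a set $N$ with operations $+,\cdot$ such that $(N,+)$ is a (not necessarily abelian) group, $(N,\cdot)$ is a semigroup, and $(x+y)z=xz+yz$ for all $x,y,z\in N$ (right distributivity). It need not be zero-symmetric, i.e. $x0=0$ is not required (while $0x=0$ is automatic). An ideal $I$ of $N$ is a normal subgroup of $(N,+)$ with $in\in I$ and $n(i+m)-nm\in I$ for all $i\in I$, $n,m\in N$; ideals are exactly the kernels of nearring homomorphisms. $\mathrm{Aut}(A,+)$ is the set of automorphisms of the additive group of $A$; $\mathrm{Map}(X,Y)$ is the set of all functions $X\to Y$; $X^2=X\times X$. An extension of $A$ by $B$ is a nearring $N$ together with an injective nearring homomorphism $i:A\to N$ with $i(A)$ an ideal of $N$, and a surjective nearring homomorphism $p:N\to B$ with $\ker(p)=i(A)$ (so $N/i(A)\cong B$). *)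

theory Defs
  imports "HOL-Algebra.AbelCoset"
begin

text \<open>
  Nearrings are carried by the HOL-Algebra ring record, so that the library's group theory applies
  to the additive group \<open>add_monoid N\<close>, which need not be commutative. Nearrings have no unit: the
  field \<open>one\<close> of the record is never referred to.
\<close>

locale nearring =
  fixes N (structure)
  assumes a_group: "group (add_monoid N)"
    and m_closed: "\<lbrakk>x \<in> carrier N; y \<in> carrier N\<rbrakk> \<Longrightarrow> x \<otimes> y \<in> carrier N"
    and m_assoc: "\<lbrakk>x \<in> carrier N; y \<in> carrier N; z \<in> carrier N\<rbrakk>
      \<Longrightarrow> (x \<otimes> y) \<otimes> z = x \<otimes> (y \<otimes> z)"
    and r_distr: "\<lbrakk>x \<in> carrier N; y \<in> carrier N; z \<in> carrier N\<rbrakk>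
      \<Longrightarrow> (x \<oplus> y) \<otimes> z = x \<otimes> z \<oplus> y \<otimes> z"

locale nearring_ideal = nearring N for I and N (structure) +
  assumes a_normal: "I \<lhd> add_monoid N"
    and mult_right: "\<lbrakk>i \<in> I; n \<in> carrier N\<rbrakk> \<Longrightarrow> i \<otimes> n \<in> I"
    and mult_left_diff: "\<lbrakk>i \<in> I; n \<in> carrier N; m \<in> carrier N\<rbrakk>
      \<Longrightarrow> n \<otimes> (i \<oplus> m) \<ominus> n \<otimes> m \<in> I"

definition nearring_hom ::
  "('a, 'm) ring_scheme \<Rightarrow> ('b, 'n) ring_scheme \<Rightarrow> ('a \<Rightarrow> 'b) set" where
  "nearring_hom N M = hom (add_monoid N) (add_monoid M) \<inter> hom N M"

definition nearring_isomorphic ::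
  "('a, 'm) ring_scheme \<Rightarrow> ('b, 'n) ring_scheme \<Rightarrow> bool" where
  "nearring_isomorphic N M \<longleftrightarrow>
     (\<exists>h \<in> nearring_hom N M. bij_betw h (carrier N) (carrier M))"

definition nearring_extension ::
  "('a, 'm) ring_scheme \<Rightarrow> ('b, 'n) ring_scheme \<Rightarrow> ('c, 'k) ring_scheme
    \<Rightarrow> ('a \<Rightarrow> 'c) \<Rightarrow> ('c \<Rightarrow> 'b) \<Rightarrow> bool" where
  "nearring_extension A B N i p \<longleftrightarrow>
     nearring N
   \<and> i \<in> nearring_hom A N \<and> inj_on i (carrier A) \<and> nearring_ideal (i ` carrier A) N
   \<and> p \<in> nearring_hom N B \<and> p ` carrier N = carrier B
   \<and> a_kernel N B p = i ` carrier A"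

text \<open>
  The quintuple \<open>E(\<psi>, [-,-], \<alpha>, \<beta>, \<langle>-,-\<rangle>)\<close> with its initial conditions; \<open>br\<close> is the bracket
  \<open>[-,-]\<close> and \<open>ang\<close> is \<open>\<langle>-,-\<rangle>\<close>. Only values on the carriers matter.
\<close>

locale extension_quintuple =
  fixes A :: "('a, 'm) ring_scheme" and B :: "('b, 'n) ring_scheme"
    and \<psi> :: "'b \<Rightarrow> 'a \<Rightarrow> 'a" and br :: "'b \<Rightarrow> 'b \<Rightarrow> 'a"
    and \<alpha> :: "'b \<Rightarrow> 'a \<Rightarrow> 'a \<Rightarrow> 'a" and \<beta> :: "'b \<Rightarrow> 'b \<Rightarrow> 'a \<Rightarrow> 'a"
    and ang :: "'b \<Rightarrow> 'b \<Rightarrow> 'a"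
  assumes psi_aut: "b \<in> carrier B \<Longrightarrow> \<psi> b \<in> iso (add_monoid A) (add_monoid A)"
    and br_closed: "\<lbrakk>b1 \<in> carrier B; b2 \<in> carrier B\<rbrakk> \<Longrightarrow> br b1 b2 \<in> carrier A"
    and alpha_closed: "\<lbrakk>b \<in> carrier B; a1 \<in> carrier A; a2 \<in> carrier A\<rbrakk>
      \<Longrightarrow> \<alpha> b a1 a2 \<in> carrier A"
    and beta_closed: "\<lbrakk>b1 \<in> carrier B; b2 \<in> carrier B; a \<in> carrier A\<rbrakk>
      \<Longrightarrow> \<beta> b1 b2 a \<in> carrier A"
    and ang_closed: "\<lbrakk>b1 \<in> carrier B; b2 \<in> carrier B\<rbrakk> \<Longrightarrow> ang b1 b2 \<in> carrier A"
    and br_zero_right: "b \<in> carrier B \<Longrightarrow> br b \<zero>\<^bsub>B\<^esub> = \<zero>\<^bsub>A\<^esub>"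
    and br_zero_left: "b \<in> carrier B \<Longrightarrow> br \<zero>\<^bsub>B\<^esub> b = \<zero>\<^bsub>A\<^esub>"
    and alpha_add: "\<lbrakk>b \<in> carrier B; a1 \<in> carrier A; a2 \<in> carrier A; a \<in> carrier A\<rbrakk>
      \<Longrightarrow> \<alpha> b (a1 \<oplus>\<^bsub>A\<^esub> a2) a = \<alpha> b a1 a \<oplus>\<^bsub>A\<^esub> \<alpha> b a2 a"
    and alpha_zero: "\<lbrakk>a1 \<in> carrier A; a2 \<in> carrier A\<rbrakk> \<Longrightarrow> \<alpha> \<zero>\<^bsub>B\<^esub> a1 a2 = a1 \<otimes>\<^bsub>A\<^esub> a2"
    and beta_zero_left: "\<lbrakk>b \<in> carrier B; a \<in> carrier A\<rbrakk> \<Longrightarrow> \<beta> \<zero>\<^bsub>B\<^esub> b a = \<zero>\<^bsub>A\<^esub>"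
    and beta_at_zero: "\<lbrakk>b1 \<in> carrier B; b2 \<in> carrier B\<rbrakk> \<Longrightarrow> \<beta> b1 b2 \<zero>\<^bsub>A\<^esub> = \<zero>\<^bsub>A\<^esub>"
    and ang_zero_left: "b \<in> carrier B \<Longrightarrow> ang \<zero>\<^bsub>B\<^esub> b = \<zero>\<^bsub>A\<^esub>"

text \<open>
  The structure \<open>A \<boxtimes> B\<close>. The initial conditions make \<open>(0, 0)\<close> additively idempotent, so it is the
  only possible neutral element for the addition; fixing it as the \<open>zero\<close> field therefore
  does not restrict when \<open>A \<boxtimes> B\<close> is a nearring.
\<close>

definition box_product ::
  "('a, 'm) ring_scheme \<Rightarrow> ('b, 'n) ring_scheme
    \<Rightarrow> ('b \<Rightarrow> 'a \<Rightarrow> 'a) \<Rightarrow> ('b \<Rightarrow> 'b \<Rightarrow> 'a) \<Rightarrow> ('b \<Rightarrow> 'a \<Rightarrow> 'a \<Rightarrow> 'a)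
    \<Rightarrow> ('b \<Rightarrow> 'b \<Rightarrow> 'a \<Rightarrow> 'a) \<Rightarrow> ('b \<Rightarrow> 'b \<Rightarrow> 'a) \<Rightarrow> ('a \<times> 'b) ring" where
  "box_product A B \<psi> br \<alpha> \<beta> ang =
    \<lparr> carrier = carrier A \<times> carrier B,
      mult = (\<lambda>(a1, b1) (a2, b2).
        (\<alpha> b2 a1 a2 \<oplus>\<^bsub>A\<^esub> \<beta> b1 b2 a2 \<oplus>\<^bsub>A\<^esub> ang b1 b2, b1 \<otimes>\<^bsub>B\<^esub> b2)),
      one = undefined,
      zero = (\<zero>\<^bsub>A\<^esub>, \<zero>\<^bsub>B\<^esub>),
      add = (\<lambda>(a1, b1) (a2, b2).
        (a1 \<oplus>\<^bsub>A\<^esub> \<psi> b1 a2 \<oplus>\<^bsub>A\<^esub> br b1 b2, b1 \<oplus>\<^bsub>B\<^esub> b2)) \<rparr>"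

definition inner_map :: "('a, 'm) ring_scheme \<Rightarrow> 'a \<Rightarrow> 'a \<Rightarrow> 'a" where
  "inner_map A c g = c \<oplus>\<^bsub>A\<^esub> g \<ominus>\<^bsub>A\<^esub> c"

definition box_incl :: "('b, 'n) ring_scheme \<Rightarrow> 'a \<Rightarrow> 'a \<times> 'b" where
  "box_incl B a = (a, \<zero>\<^bsub>B\<^esub>)"

definition box_proj :: "'a \<times> 'b \<Rightarrow> 'b" where
  "box_proj = (\<lambda>(a, b). b)"

end

theory Submission
  imports Defs
begin

text \<open>
  Fix the \<open>B\<close>-components of three elements of \<open>A \<boxtimes> B\<close>. Each of the three laws (associativity of
  addition, associativity of multiplication, right distributivity) is then an equation in \<open>A\<close>, its
  \<open>B\<close>-component being a law of \<open>B\<close>. After cancelling the common left summand, where there is one,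
  the equation takes in all three cases the shape \<open>f x + p = q + g x + r\<close>, where \<open>x\<close> is
  one of the three \<open>A\<close>-components, the terms \<open>p\<close>, \<open>q\<close>, \<open>r\<close> do not depend on \<open>x\<close>, and \<open>f\<close>, \<open>g\<close> map zero to zero. Putting
  \<open>x = 0\<close> gives \<open>p = q + r\<close>, and substituting this back and cancelling \<open>r\<close> gives
  \<open>f x + q = q + g x\<close>; conversely these two equations give the first
  (lemma \<open>split_at_one\<close>). So every law is equivalent to exactly two conditions, one free of \<open>x\<close>
  and one that relates \<open>f\<close> to \<open>g\<close>:

  \<^item> for associativity of addition, the cocycle identity for the bracket, and the identity by which
    \<open>\<psi>\<close> is additive up to inner automorphisms (\<open>add_assoc_at_iff\<close>);
  \<^item> for associativity of multiplication, the associativity condition on the part of the product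
    free of \<open>a1\<close>, and the rule for composing \<open>\<alpha>\<close> with itself; here \<open>q = 0\<close>
    (\<open>mult_assoc_at_iff\<close>);
  \<^item> for right distributivity, the condition that compares \<open>\<beta>\<close> and the angle bracket at \<open>b1 + b2\<close>
    with their values at \<open>b1\<close> and at \<open>b2\<close>, and the commutation of \<open>\<alpha>\<close> with \<open>\<psi>\<close>, twisted by
    \<open>\<beta> b1 b3 a3 + ang b1 b3\<close> (\<open>r_distr_at_iff\<close>).

  What remains for a nearring is a neutral element and additive inverses, and these follow from
  associativity (\<open>add_group_iff\<close>): associativity makes \<open>\<psi>\<^sub>0\<close> idempotent, hence the identity because
  it is injective, so \<open>(0, 0)\<close> is neutral, and a left inverse of \<open>(a, b)\<close> is found by solving for
  its \<open>A\<close>-component.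

  For the extension, the initial conditions and \<open>\<psi>\<^sub>0 = id\<close> make \<open>\<xi>\<close> a homomorphism. The map \<open>\<eta>\<close> is
  one by the definition of the operations, and \<open>(A, 0)\<close> is an ideal because it is
  the kernel of \<open>\<eta>\<close>.
\<close>


section \<open>Groups and nearrings\<close>

text \<open>
  The conditions on a quintuple come in pairs because of this equivalence. The instance
  \<open>x = \<one>\<close> isolates the constants, and cancelling \<open>r\<close> then leaves the twisted commutation of \<open>f\<close>
  and \<open>g\<close> with \<open>q\<close>.
\<close>

lemma (in group) split_at_one:
  assumes f: "f \<in> carrier G \<rightarrow> carrier G" "f \<one> = \<one>"
    and g: "g \<in> carrier G \<rightarrow> carrier G" "g \<one> = \<one>"
    and p: "p \<in> carrier G" and q: "q \<in> carrier G" and r: "r \<in> carrier G"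
  shows "(\<forall>x \<in> carrier G. f x \<otimes> p = q \<otimes> g x \<otimes> r)
    \<longleftrightarrow> p = q \<otimes> r \<and> (\<forall>x \<in> carrier G. f x \<otimes> q = q \<otimes> g x)"
proof -
  have p_eq: "p = q \<otimes> r" if "\<forall>x \<in> carrier G. f x \<otimes> p = q \<otimes> g x \<otimes> r"
    using bspec[OF that one_closed] f g p q r by simp
  have "f x \<otimes> (q \<otimes> r) = q \<otimes> g x \<otimes> r \<longleftrightarrow> f x \<otimes> q = q \<otimes> g x" if x: "x \<in> carrier G" for x
  proof -
    have fx: "f x \<in> carrier G" and gx: "g x \<in> carrier G"
      using f g x by auto
    have "f x \<otimes> (q \<otimes> r) = f x \<otimes> q \<otimes> r"
      using fx q r by (simp add: m_assoc)
    then show ?thesis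
      using fx gx q r by simp
  qed
  then show ?thesis
    using p_eq by metis
qed

text \<open>
  Group theory in additive notation. The interpretation for abelian groups does not apply, since
  \<open>(N, +)\<close> need not commute.
\<close>

sublocale nearring \<subseteq> add: group "add_monoid N"
  rewrites "carrier (add_monoid N) = carrier N"
    and "mult (add_monoid N) = add N"
    and "one (add_monoid N) = zero N"
    and "m_inv (add_monoid N) = a_inv N"
  by (rule a_group) (simp_all add: a_inv_def)

lemma (in nearring) zero_mult:
  assumes "x \<in> carrier N"
  shows "\<zero> \<otimes> x = \<zero>"
  using r_distr[of \<zero> \<zero> x] assms by (simp add: m_closed)

text \<open>
  Normality is the group-theoretic fact about kernels. The multiplicative conditions hold because
  \<open>h i = 0\<close> turns \<open>h (i n)\<close> into \<open>0 (h n) = 0\<close> and makes \<open>n (i + m)\<close> and \<open>n m\<close> have the same image.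
\<close>

lemma nearring_hom_kernel_ideal:
  assumes N: "nearring N" and M: "nearring M" and h: "h \<in> nearring_hom N M"
  shows "nearring_ideal (a_kernel N M h) N"
proof -
  interpret N: nearring N by (rule N)
  interpret M: nearring M by (rule M)
  interpret h: group_hom "add_monoid N" "add_monoid M" h
    using h N.a_group M.a_group
    by (simp add: group_hom_def group_hom_axioms_def nearring_hom_def)
  have h_closed: "h x \<in> carrier M" if "x \<in> carrier N" for x
    using h.hom_closed that by simp
  have h_add: "h (x \<oplus>\<^bsub>N\<^esub> y) = h x \<oplus>\<^bsub>M\<^esub> h y" if "x \<in> carrier N" "y \<in> carrier N" for x y
    using h.hom_mult that by simp
  have h_inv: "h (\<ominus>\<^bsub>N\<^esub> x) = \<ominus>\<^bsub>M\<^esub> h x" if "x \<in> carrier N" for x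
    using h.hom_inv that by (simp add: a_inv_def)
  have h_mult: "h (x \<otimes>\<^bsub>N\<^esub> y) = h x \<otimes>\<^bsub>M\<^esub> h y" if "x \<in> carrier N" "y \<in> carrier N" for x y
    using h that by (auto simp: nearring_hom_def hom_def)
  show ?thesis
  proof (intro nearring_ideal.intro nearring_ideal_axioms.intro N)
    show "a_kernel N M h \<lhd> add_monoid N"
      unfolding a_kernel_def by (rule h.normal_kernel)
    show "i \<otimes>\<^bsub>N\<^esub> n \<in> a_kernel N M h"
      if "i \<in> a_kernel N M h" "n \<in> carrier N" for i n
      using that by (simp add: a_kernel_def' h_mult h_closed N.m_closed M.zero_mult)
    show "n \<otimes>\<^bsub>N\<^esub> (i \<oplus>\<^bsub>N\<^esub> m) \<ominus>\<^bsub>N\<^esub> n \<otimes>\<^bsub>N\<^esub> m \<in> a_kernel N M h"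
      if "i \<in> a_kernel N M h" "n \<in> carrier N" "m \<in> carrier N" for i n m
      using that
      by (simp add: a_kernel_def' a_minus_def h_add h_inv h_mult h_closed N.m_closed M.m_closed)
  qed
qed


section \<open>The operations of the box product\<close>

locale box_data =
  A: nearring A + B: nearring B + extension_quintuple A B \<psi> br \<alpha> \<beta> ang
  for A :: "('a, 'm) ring_scheme" and B :: "('b, 'n) ring_scheme"
    and \<psi> :: "'b \<Rightarrow> 'a \<Rightarrow> 'a" and br :: "'b \<Rightarrow> 'b \<Rightarrow> 'a"
    and \<alpha> :: "'b \<Rightarrow> 'a \<Rightarrow> 'a \<Rightarrow> 'a" and \<beta> :: "'b \<Rightarrow> 'b \<Rightarrow> 'a \<Rightarrow> 'a"
    and ang :: "'b \<Rightarrow> 'b \<Rightarrow> 'a"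
begin

abbreviation N :: "('a \<times> 'b) ring" where
  "N \<equiv> box_product A B \<psi> br \<alpha> \<beta> ang"

lemma carrier_box: "carrier N = carrier A \<times> carrier B"
  by (simp add: box_product_def)

lemma zero_box: "\<zero>\<^bsub>N\<^esub> = (\<zero>\<^bsub>A\<^esub>, \<zero>\<^bsub>B\<^esub>)"
  by (simp add: box_product_def)

lemma add_box:
  "(a1, b1) \<oplus>\<^bsub>N\<^esub> (a2, b2) = (a1 \<oplus>\<^bsub>A\<^esub> \<psi> b1 a2 \<oplus>\<^bsub>A\<^esub> br b1 b2, b1 \<oplus>\<^bsub>B\<^esub> b2)"
  by (simp add: box_product_def)

lemma mult_box:
  "(a1, b1) \<otimes>\<^bsub>N\<^esub> (a2, b2)
    = (\<alpha> b2 a1 a2 \<oplus>\<^bsub>A\<^esub> \<beta> b1 b2 a2 \<oplus>\<^bsub>A\<^esub> ang b1 b2, b1 \<otimes>\<^bsub>B\<^esub> b2)"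
  by (simp add: box_product_def)

lemma psi_closed: "b \<in> carrier B \<Longrightarrow> a \<in> carrier A \<Longrightarrow> \<psi> b a \<in> carrier A"
  using psi_aut[of b] by (auto simp: iso_def hom_def)

lemma psi_add:
  "b \<in> carrier B \<Longrightarrow> x \<in> carrier A \<Longrightarrow> y \<in> carrier A
    \<Longrightarrow> \<psi> b (x \<oplus>\<^bsub>A\<^esub> y) = \<psi> b x \<oplus>\<^bsub>A\<^esub> \<psi> b y"
  using psi_aut[of b] by (auto simp: iso_def hom_def)

lemma psi_inj:
  "b \<in> carrier B \<Longrightarrow> x \<in> carrier A \<Longrightarrow> y \<in> carrier A \<Longrightarrow> \<psi> b x = \<psi> b y \<Longrightarrow> x = y"
  using psi_aut[of b] by (auto simp: iso_def bij_betw_def inj_on_def)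

lemma psi_zero: "b \<in> carrier B \<Longrightarrow> \<psi> b \<zero>\<^bsub>A\<^esub> = \<zero>\<^bsub>A\<^esub>"
  using psi_add[of b "\<zero>\<^bsub>A\<^esub>" "\<zero>\<^bsub>A\<^esub>"] by (simp add: psi_closed)

lemma alpha_zero_left: "b \<in> carrier B \<Longrightarrow> a \<in> carrier A \<Longrightarrow> \<alpha> b \<zero>\<^bsub>A\<^esub> a = \<zero>\<^bsub>A\<^esub>"
  using alpha_add[of b "\<zero>\<^bsub>A\<^esub>" "\<zero>\<^bsub>A\<^esub>" a] by (simp add: alpha_closed)

lemmas closed = psi_closed br_closed alpha_closed beta_closed ang_closed A.m_closed B.m_closed

text \<open>
  The twisted commutations involve only some of the three elements of \<open>B\<close> over which a law
  quantifies; nonemptiness allows the quantifiers over the others to be dropped.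
\<close>

lemma carrier_B_nonempty: "carrier B \<noteq> {}"
  using B.add.one_closed by blast

lemma add_box_closed: "x \<in> carrier N \<Longrightarrow> y \<in> carrier N \<Longrightarrow> x \<oplus>\<^bsub>N\<^esub> y \<in> carrier N"
  by (cases x; cases y) (simp add: carrier_box add_box closed)

lemma mult_box_closed: "x \<in> carrier N \<Longrightarrow> y \<in> carrier N \<Longrightarrow> x \<otimes>\<^bsub>N\<^esub> y \<in> carrier N"
  by (cases x; cases y) (simp add: carrier_box mult_box closed)


section \<open>The additive group\<close>

lemma inner_map_eq_iff:
  assumes "c \<in> carrier A" "g \<in> carrier A" "x \<in> carrier A"
  shows "x = inner_map A c g \<longleftrightarrow> x \<oplus>\<^bsub>A\<^esub> c = c \<oplus>\<^bsub>A\<^esub> g"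
  using A.add.inv_solve_right[of x "c \<oplus>\<^bsub>A\<^esub> g" c] assms
  by (auto simp: inner_map_def a_minus_def)

text \<open>
  The \<open>A\<close>-components of both sides begin with \<open>a1 + \<psi> b1 a2\<close>. Cancelling it leaves an equation in
  \<open>a3\<close> alone, to which \<open>split_at_one\<close> applies with \<open>f = \<psi> b1 \<circ> \<psi> b2\<close> and \<open>g = \<psi> (b1 + b2)\<close>.
\<close>

lemma add_assoc_at_iff:
  assumes b: "b1 \<in> carrier B" "b2 \<in> carrier B" "b3 \<in> carrier B"
  shows "(\<forall>a1 \<in> carrier A. \<forall>a2 \<in> carrier A. \<forall>a3 \<in> carrier A.
      ((a1, b1) \<oplus>\<^bsub>N\<^esub> (a2, b2)) \<oplus>\<^bsub>N\<^esub> (a3, b3) = (a1, b1) \<oplus>\<^bsub>N\<^esub> ((a2, b2) \<oplus>\<^bsub>N\<^esub> (a3, b3)))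
    \<longleftrightarrow> br b1 b2 \<oplus>\<^bsub>A\<^esub> br (b1 \<oplus>\<^bsub>B\<^esub> b2) b3
        = \<psi> b1 (br b2 b3) \<oplus>\<^bsub>A\<^esub> br b1 (b2 \<oplus>\<^bsub>B\<^esub> b3)
      \<and> (\<forall>a \<in> carrier A.
          (\<psi> b1 \<circ> \<psi> b2) a = (inner_map A (br b1 b2) \<circ> \<psi> (b1 \<oplus>\<^bsub>B\<^esub> b2)) a)"
proof -
  let ?c = "br b1 b2" and ?d = "br (b1 \<oplus>\<^bsub>B\<^esub> b2) b3"
  let ?e = "\<psi> b1 (br b2 b3) \<oplus>\<^bsub>A\<^esub> br b1 (b2 \<oplus>\<^bsub>B\<^esub> b3)"
  let ?eq = "\<lambda>a. \<psi> b1 (\<psi> b2 a) \<oplus>\<^bsub>A\<^esub> ?e = ?c \<oplus>\<^bsub>A\<^esub> \<psi> (b1 \<oplus>\<^bsub>B\<^esub> b2) a \<oplus>\<^bsub>A\<^esub> ?d"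
  have cancel: "((a1, b1) \<oplus>\<^bsub>N\<^esub> (a2, b2)) \<oplus>\<^bsub>N\<^esub> (a3, b3) = (a1, b1) \<oplus>\<^bsub>N\<^esub> ((a2, b2) \<oplus>\<^bsub>N\<^esub> (a3, b3))
      \<longleftrightarrow> ?eq a3"
    if "a1 \<in> carrier A" "a2 \<in> carrier A" "a3 \<in> carrier A" for a1 a2 a3
    using b that
    by (simp add: add_box psi_add closed A.add.m_assoc B.add.m_assoc eq_commute)
  have "(\<forall>a1 \<in> carrier A. \<forall>a2 \<in> carrier A. \<forall>a3 \<in> carrier A.
      ((a1, b1) \<oplus>\<^bsub>N\<^esub> (a2, b2)) \<oplus>\<^bsub>N\<^esub> (a3, b3) = (a1, b1) \<oplus>\<^bsub>N\<^esub> ((a2, b2) \<oplus>\<^bsub>N\<^esub> (a3, b3)))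
    \<longleftrightarrow> (\<forall>a \<in> carrier A. ?eq a)"
    using cancel A.add.one_closed by blast
  also have "\<dots> \<longleftrightarrow> ?e = ?c \<oplus>\<^bsub>A\<^esub> ?d
      \<and> (\<forall>a \<in> carrier A. \<psi> b1 (\<psi> b2 a) \<oplus>\<^bsub>A\<^esub> ?c = ?c \<oplus>\<^bsub>A\<^esub> \<psi> (b1 \<oplus>\<^bsub>B\<^esub> b2) a)"
    by (rule A.add.split_at_one) (use b in \<open>auto simp: closed psi_zero\<close>)
  also have "\<dots> \<longleftrightarrow> ?c \<oplus>\<^bsub>A\<^esub> ?d = ?e
      \<and> (\<forall>a \<in> carrier A. (\<psi> b1 \<circ> \<psi> b2) a = (inner_map A ?c \<circ> \<psi> (b1 \<oplus>\<^bsub>B\<^esub> b2)) a)"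
    using b by (auto simp: inner_map_eq_iff closed)
  finally show ?thesis .
qed

lemma add_assoc_iff:
  "(\<forall>x \<in> carrier N. \<forall>y \<in> carrier N. \<forall>z \<in> carrier N.
      (x \<oplus>\<^bsub>N\<^esub> y) \<oplus>\<^bsub>N\<^esub> z = x \<oplus>\<^bsub>N\<^esub> (y \<oplus>\<^bsub>N\<^esub> z))
    \<longleftrightarrow>
        (\<forall>b1 \<in> carrier B. \<forall>b2 \<in> carrier B. \<forall>b3 \<in> carrier B.
          br b1 b2 \<oplus>\<^bsub>A\<^esub> br (b1 \<oplus>\<^bsub>B\<^esub> b2) b3
          = \<psi> b1 (br b2 b3) \<oplus>\<^bsub>A\<^esub> br b1 (b2 \<oplus>\<^bsub>B\<^esub> b3))
      \<and> (\<forall>b1 \<in> carrier B. \<forall>b2 \<in> carrier B. \<forall>a \<in> carrier A.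
          (\<psi> b1 \<circ> \<psi> b2) a = (inner_map A (br b1 b2) \<circ> \<psi> (b1 \<oplus>\<^bsub>B\<^esub> b2)) a)"
  (is "?L \<longleftrightarrow> ?R")
proof -
  have "?L \<longleftrightarrow> (\<forall>b1 \<in> carrier B. \<forall>b2 \<in> carrier B. \<forall>b3 \<in> carrier B.
      \<forall>a1 \<in> carrier A. \<forall>a2 \<in> carrier A. \<forall>a3 \<in> carrier A.
      ((a1, b1) \<oplus>\<^bsub>N\<^esub> (a2, b2)) \<oplus>\<^bsub>N\<^esub> (a3, b3) = (a1, b1) \<oplus>\<^bsub>N\<^esub> ((a2, b2) \<oplus>\<^bsub>N\<^esub> (a3, b3)))"
    unfolding carrier_box by blast
  also have "\<dots> \<longleftrightarrow> ?R"
    using carrier_B_nonempty by (simp add: add_assoc_at_iff ball_conj_distrib del: o_apply) blast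
  finally show ?thesis .
qed

text \<open>
  Associativity at \<open>(0, 0)\<close>, \<open>(0, 0)\<close>, \<open>(x, 0)\<close> says that \<open>\<psi>\<^sub>0\<close> is idempotent. An idempotent
  injection is the identity, so \<open>(0, 0)\<close> is a left neutral element. Left inverses exist because the
  first summand enters the \<open>A\<close>-component of a sum untwisted.
\<close>

lemma add_group_iff:
  "group (add_monoid N) \<longleftrightarrow>
    (\<forall>x \<in> carrier N. \<forall>y \<in> carrier N. \<forall>z \<in> carrier N.
      (x \<oplus>\<^bsub>N\<^esub> y) \<oplus>\<^bsub>N\<^esub> z = x \<oplus>\<^bsub>N\<^esub> (y \<oplus>\<^bsub>N\<^esub> z))"
proof
  assume "group (add_monoid N)"
  then interpret group "add_monoid N" .
  show "\<forall>x \<in> carrier N. \<forall>y \<in> carrier N. \<forall>z \<in> carrier N.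
      (x \<oplus>\<^bsub>N\<^esub> y) \<oplus>\<^bsub>N\<^esub> z = x \<oplus>\<^bsub>N\<^esub> (y \<oplus>\<^bsub>N\<^esub> z)"
    using m_assoc by simp
next
  assume assoc: "\<forall>x \<in> carrier N. \<forall>y \<in> carrier N. \<forall>z \<in> carrier N.
      (x \<oplus>\<^bsub>N\<^esub> y) \<oplus>\<^bsub>N\<^esub> z = x \<oplus>\<^bsub>N\<^esub> (y \<oplus>\<^bsub>N\<^esub> z)"
  have "\<psi> \<zero>\<^bsub>B\<^esub> (\<psi> \<zero>\<^bsub>B\<^esub> x) = \<psi> \<zero>\<^bsub>B\<^esub> x" if "x \<in> carrier A" for x
    using assoc[rule_format, of "(\<zero>\<^bsub>A\<^esub>, \<zero>\<^bsub>B\<^esub>)" "(\<zero>\<^bsub>A\<^esub>, \<zero>\<^bsub>B\<^esub>)" "(x, \<zero>\<^bsub>B\<^esub>)"] that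
    by (simp add: carrier_box add_box closed psi_zero br_zero_left)
  then have psi0: "\<psi> \<zero>\<^bsub>B\<^esub> a = a" if "a \<in> carrier A" for a
    using that by (meson psi_inj psi_closed B.add.one_closed)
  show "group (add_monoid N)"
  proof (rule groupI)
    show "\<one>\<^bsub>add_monoid N\<^esub> \<otimes>\<^bsub>add_monoid N\<^esub> x = x" if "x \<in> carrier (add_monoid N)" for x
      using that by (cases x) (simp add: carrier_box zero_box add_box psi0 br_zero_left)
    show "\<exists>y \<in> carrier (add_monoid N). y \<otimes>\<^bsub>add_monoid N\<^esub> x = \<one>\<^bsub>add_monoid N\<^esub>"
      if "x \<in> carrier (add_monoid N)" for x
    proof -
      obtain a b where x: "x = (a, b)"
        by (cases x)
      have a: "a \<in> carrier A" and b: "b \<in> carrier B"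
        using that by (simp_all add: x carrier_box)
      \<comment> \<open>\<open>?s\<close> is what \<open>(y, -b) + (a, b)\<close> adds to \<open>y\<close> in the \<open>A\<close>-component.\<close>
      let ?s = "\<psi> (\<ominus>\<^bsub>B\<^esub> b) a \<oplus>\<^bsub>A\<^esub> br (\<ominus>\<^bsub>B\<^esub> b) b"
      have "(\<ominus>\<^bsub>A\<^esub> ?s, \<ominus>\<^bsub>B\<^esub> b) \<oplus>\<^bsub>N\<^esub> x = \<zero>\<^bsub>N\<^esub>"
        using a b by (simp add: x add_box zero_box closed A.add.m_assoc A.add.l_inv)
      moreover have "(\<ominus>\<^bsub>A\<^esub> ?s, \<ominus>\<^bsub>B\<^esub> b) \<in> carrier N"
        using a b by (simp add: carrier_box closed)
      ultimately show ?thesis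
        by auto
    qed
  qed (use assoc in \<open>simp_all add: add_box_closed, simp add: carrier_box zero_box\<close>)
qed


section \<open>Multiplication and right distributivity\<close>

text \<open>
  Additivity of \<open>\<alpha> b3\<close> in its first argument separates \<open>\<alpha> b3 (\<alpha> b2 a1 a2) a3\<close> from the terms free
  of \<open>a1\<close>. So \<open>split_at_one\<close> applies with \<open>q = 0\<close>, where its twisted commutation reads \<open>f = g\<close>. The
  term \<open>c\<close> is the \<open>A\<close>-component of \<open>(a2, b2) (a3, b3)\<close>.
\<close>

lemma mult_assoc_at_iff:
  assumes b: "b1 \<in> carrier B" "b2 \<in> carrier B" "b3 \<in> carrier B"
    and a: "a2 \<in> carrier A" "a3 \<in> carrier A"
  defines "c \<equiv> \<alpha> b3 a2 a3 \<oplus>\<^bsub>A\<^esub> \<beta> b2 b3 a3 \<oplus>\<^bsub>A\<^esub> ang b2 b3"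
  shows "(\<forall>a1 \<in> carrier A.
      ((a1, b1) \<otimes>\<^bsub>N\<^esub> (a2, b2)) \<otimes>\<^bsub>N\<^esub> (a3, b3) = (a1, b1) \<otimes>\<^bsub>N\<^esub> ((a2, b2) \<otimes>\<^bsub>N\<^esub> (a3, b3)))
    \<longleftrightarrow> \<alpha> b3 (\<beta> b1 b2 a2 \<oplus>\<^bsub>A\<^esub> ang b1 b2) a3
          \<oplus>\<^bsub>A\<^esub> \<beta> (b1 \<otimes>\<^bsub>B\<^esub> b2) b3 a3 \<oplus>\<^bsub>A\<^esub> ang (b1 \<otimes>\<^bsub>B\<^esub> b2) b3
        = \<beta> b1 (b2 \<otimes>\<^bsub>B\<^esub> b3) c \<oplus>\<^bsub>A\<^esub> ang b1 (b2 \<otimes>\<^bsub>B\<^esub> b3)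
      \<and> (\<forall>a1 \<in> carrier A. \<alpha> b3 (\<alpha> b2 a1 a2) a3 = \<alpha> (b2 \<otimes>\<^bsub>B\<^esub> b3) a1 c)"
proof -
  let ?p = "\<alpha> b3 (\<beta> b1 b2 a2 \<oplus>\<^bsub>A\<^esub> ang b1 b2) a3
          \<oplus>\<^bsub>A\<^esub> \<beta> (b1 \<otimes>\<^bsub>B\<^esub> b2) b3 a3 \<oplus>\<^bsub>A\<^esub> ang (b1 \<otimes>\<^bsub>B\<^esub> b2) b3"
  let ?r = "\<beta> b1 (b2 \<otimes>\<^bsub>B\<^esub> b3) c \<oplus>\<^bsub>A\<^esub> ang b1 (b2 \<otimes>\<^bsub>B\<^esub> b3)"
  have c: "c \<in> carrier A"
    using a b by (simp add: c_def closed)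
  have c_assoc: "c = \<alpha> b3 a2 a3 \<oplus>\<^bsub>A\<^esub> (\<beta> b2 b3 a3 \<oplus>\<^bsub>A\<^esub> ang b2 b3)"
    using a b by (simp add: c_def closed A.add.m_assoc)
  have "((a1, b1) \<otimes>\<^bsub>N\<^esub> (a2, b2)) \<otimes>\<^bsub>N\<^esub> (a3, b3) = (a1, b1) \<otimes>\<^bsub>N\<^esub> ((a2, b2) \<otimes>\<^bsub>N\<^esub> (a3, b3))
      \<longleftrightarrow> \<alpha> b3 (\<alpha> b2 a1 a2) a3 \<oplus>\<^bsub>A\<^esub> ?p = \<zero>\<^bsub>A\<^esub> \<oplus>\<^bsub>A\<^esub> \<alpha> (b2 \<otimes>\<^bsub>B\<^esub> b3) a1 c \<oplus>\<^bsub>A\<^esub> ?r"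
    if "a1 \<in> carrier A" for a1
    using a b c that
    by (simp add: mult_box alpha_add closed A.add.m_assoc B.m_assoc flip: c_assoc)
  then have "(\<forall>a1 \<in> carrier A.
      ((a1, b1) \<otimes>\<^bsub>N\<^esub> (a2, b2)) \<otimes>\<^bsub>N\<^esub> (a3, b3) = (a1, b1) \<otimes>\<^bsub>N\<^esub> ((a2, b2) \<otimes>\<^bsub>N\<^esub> (a3, b3)))
    \<longleftrightarrow> (\<forall>a1 \<in> carrier A.
      \<alpha> b3 (\<alpha> b2 a1 a2) a3 \<oplus>\<^bsub>A\<^esub> ?p = \<zero>\<^bsub>A\<^esub> \<oplus>\<^bsub>A\<^esub> \<alpha> (b2 \<otimes>\<^bsub>B\<^esub> b3) a1 c \<oplus>\<^bsub>A\<^esub> ?r)"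
    by blast
  also have "\<dots> \<longleftrightarrow> ?p = \<zero>\<^bsub>A\<^esub> \<oplus>\<^bsub>A\<^esub> ?r \<and> (\<forall>a1 \<in> carrier A.
      \<alpha> b3 (\<alpha> b2 a1 a2) a3 \<oplus>\<^bsub>A\<^esub> \<zero>\<^bsub>A\<^esub> = \<zero>\<^bsub>A\<^esub> \<oplus>\<^bsub>A\<^esub> \<alpha> (b2 \<otimes>\<^bsub>B\<^esub> b3) a1 c)"
    by (rule A.add.split_at_one) (use a b c in \<open>auto simp: closed alpha_zero_left\<close>)
  also have "\<dots> \<longleftrightarrow> ?p = ?r \<and> (\<forall>a1 \<in> carrier A.
      \<alpha> b3 (\<alpha> b2 a1 a2) a3 = \<alpha> (b2 \<otimes>\<^bsub>B\<^esub> b3) a1 c)"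
    using a b c by (simp add: closed)
  finally show ?thesis .
qed

lemma mult_assoc_iff:
  "(\<forall>x \<in> carrier N. \<forall>y \<in> carrier N. \<forall>z \<in> carrier N.
      (x \<otimes>\<^bsub>N\<^esub> y) \<otimes>\<^bsub>N\<^esub> z = x \<otimes>\<^bsub>N\<^esub> (y \<otimes>\<^bsub>N\<^esub> z))
    \<longleftrightarrow>
        (\<forall>a2 \<in> carrier A. \<forall>a3 \<in> carrier A.
         \<forall>b1 \<in> carrier B. \<forall>b2 \<in> carrier B. \<forall>b3 \<in> carrier B.
          \<alpha> b3 (\<beta> b1 b2 a2 \<oplus>\<^bsub>A\<^esub> ang b1 b2) a3
            \<oplus>\<^bsub>A\<^esub> \<beta> (b1 \<otimes>\<^bsub>B\<^esub> b2) b3 a3 \<oplus>\<^bsub>A\<^esub> ang (b1 \<otimes>\<^bsub>B\<^esub> b2) b3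
          = \<beta> b1 (b2 \<otimes>\<^bsub>B\<^esub> b3) (\<alpha> b3 a2 a3 \<oplus>\<^bsub>A\<^esub> \<beta> b2 b3 a3 \<oplus>\<^bsub>A\<^esub> ang b2 b3)
            \<oplus>\<^bsub>A\<^esub> ang b1 (b2 \<otimes>\<^bsub>B\<^esub> b3))
      \<and> (\<forall>a1 \<in> carrier A. \<forall>a2 \<in> carrier A. \<forall>a3 \<in> carrier A.
         \<forall>b2 \<in> carrier B. \<forall>b3 \<in> carrier B.
          \<alpha> b3 (\<alpha> b2 a1 a2) a3
          = \<alpha> (b2 \<otimes>\<^bsub>B\<^esub> b3) a1 (\<alpha> b3 a2 a3 \<oplus>\<^bsub>A\<^esub> \<beta> b2 b3 a3 \<oplus>\<^bsub>A\<^esub> ang b2 b3))"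
  (is "?L \<longleftrightarrow> ?R")
proof -
  have "?L \<longleftrightarrow> (\<forall>b1 \<in> carrier B. \<forall>b2 \<in> carrier B. \<forall>b3 \<in> carrier B.
      \<forall>a2 \<in> carrier A. \<forall>a3 \<in> carrier A. \<forall>a1 \<in> carrier A.
      ((a1, b1) \<otimes>\<^bsub>N\<^esub> (a2, b2)) \<otimes>\<^bsub>N\<^esub> (a3, b3) = (a1, b1) \<otimes>\<^bsub>N\<^esub> ((a2, b2) \<otimes>\<^bsub>N\<^esub> (a3, b3)))"
    unfolding carrier_box by blast
  also have "\<dots> \<longleftrightarrow> ?R"
    using carrier_B_nonempty by (simp add: mult_assoc_at_iff ball_conj_distrib del: o_apply) blast
  finally show ?thesis .
qed

text \<open>
  Both sides begin with \<open>\<alpha> b3 a1 a3\<close>, by additivity of \<open>\<alpha> b3\<close> in its first argument. Once it is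
  cancelled, \<open>\<psi> (b1 b3)\<close> is expanded over the \<open>A\<close>-component of \<open>(a2, b2) (a3, b3)\<close>, which puts the
  only term in \<open>a2\<close> between \<open>\<beta> b1 b3 a3 + ang b1 b3\<close> and the rest, as \<open>split_at_one\<close> requires.
\<close>

lemma r_distr_at_iff:
  assumes b: "b1 \<in> carrier B" "b2 \<in> carrier B" "b3 \<in> carrier B" and a3: "a3 \<in> carrier A"
  shows "(\<forall>a1 \<in> carrier A. \<forall>a2 \<in> carrier A.
      ((a1, b1) \<oplus>\<^bsub>N\<^esub> (a2, b2)) \<otimes>\<^bsub>N\<^esub> (a3, b3)
        = (a1, b1) \<otimes>\<^bsub>N\<^esub> (a3, b3) \<oplus>\<^bsub>N\<^esub> (a2, b2) \<otimes>\<^bsub>N\<^esub> (a3, b3))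
    \<longleftrightarrow> \<alpha> b3 (br b1 b2) a3 \<oplus>\<^bsub>A\<^esub> \<beta> (b1 \<oplus>\<^bsub>B\<^esub> b2) b3 a3 \<oplus>\<^bsub>A\<^esub> ang (b1 \<oplus>\<^bsub>B\<^esub> b2) b3
        = \<beta> b1 b3 a3 \<oplus>\<^bsub>A\<^esub> ang b1 b3
          \<oplus>\<^bsub>A\<^esub> \<psi> (b1 \<otimes>\<^bsub>B\<^esub> b3) (\<beta> b2 b3 a3) \<oplus>\<^bsub>A\<^esub> \<psi> (b1 \<otimes>\<^bsub>B\<^esub> b3) (ang b2 b3)
          \<oplus>\<^bsub>A\<^esub> br (b1 \<otimes>\<^bsub>B\<^esub> b3) (b2 \<otimes>\<^bsub>B\<^esub> b3)
      \<and> (\<forall>a2 \<in> carrier A.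
          \<alpha> b3 (\<psi> b1 a2) a3 \<oplus>\<^bsub>A\<^esub> \<beta> b1 b3 a3 \<oplus>\<^bsub>A\<^esub> ang b1 b3
          = \<beta> b1 b3 a3 \<oplus>\<^bsub>A\<^esub> ang b1 b3 \<oplus>\<^bsub>A\<^esub> \<psi> (b1 \<otimes>\<^bsub>B\<^esub> b3) (\<alpha> b3 a2 a3))"
proof -
  let ?p = "\<alpha> b3 (br b1 b2) a3 \<oplus>\<^bsub>A\<^esub> \<beta> (b1 \<oplus>\<^bsub>B\<^esub> b2) b3 a3 \<oplus>\<^bsub>A\<^esub> ang (b1 \<oplus>\<^bsub>B\<^esub> b2) b3"
  let ?q = "\<beta> b1 b3 a3 \<oplus>\<^bsub>A\<^esub> ang b1 b3"
  let ?r = "\<psi> (b1 \<otimes>\<^bsub>B\<^esub> b3) (\<beta> b2 b3 a3) \<oplus>\<^bsub>A\<^esub> \<psi> (b1 \<otimes>\<^bsub>B\<^esub> b3) (ang b2 b3)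
          \<oplus>\<^bsub>A\<^esub> br (b1 \<otimes>\<^bsub>B\<^esub> b3) (b2 \<otimes>\<^bsub>B\<^esub> b3)"
  let ?eq = "\<lambda>a2. \<alpha> b3 (\<psi> b1 a2) a3 \<oplus>\<^bsub>A\<^esub> ?p
    = ?q \<oplus>\<^bsub>A\<^esub> \<psi> (b1 \<otimes>\<^bsub>B\<^esub> b3) (\<alpha> b3 a2 a3) \<oplus>\<^bsub>A\<^esub> ?r"
  have cancel: "((a1, b1) \<oplus>\<^bsub>N\<^esub> (a2, b2)) \<otimes>\<^bsub>N\<^esub> (a3, b3)
        = (a1, b1) \<otimes>\<^bsub>N\<^esub> (a3, b3) \<oplus>\<^bsub>N\<^esub> (a2, b2) \<otimes>\<^bsub>N\<^esub> (a3, b3)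
      \<longleftrightarrow> ?eq a2"
    if "a1 \<in> carrier A" "a2 \<in> carrier A" for a1 a2
    using a3 b that
    by (simp add: add_box mult_box psi_add alpha_add closed A.add.m_assoc B.r_distr)
  have "(\<forall>a1 \<in> carrier A. \<forall>a2 \<in> carrier A.
      ((a1, b1) \<oplus>\<^bsub>N\<^esub> (a2, b2)) \<otimes>\<^bsub>N\<^esub> (a3, b3)
        = (a1, b1) \<otimes>\<^bsub>N\<^esub> (a3, b3) \<oplus>\<^bsub>N\<^esub> (a2, b2) \<otimes>\<^bsub>N\<^esub> (a3, b3))
    \<longleftrightarrow> (\<forall>a2 \<in> carrier A. ?eq a2)"
    using cancel A.add.one_closed by blast
  also have "\<dots> \<longleftrightarrow> ?p = ?q \<oplus>\<^bsub>A\<^esub> ?r \<and> (\<forall>a2 \<in> carrier A.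
      \<alpha> b3 (\<psi> b1 a2) a3 \<oplus>\<^bsub>A\<^esub> ?q = ?q \<oplus>\<^bsub>A\<^esub> \<psi> (b1 \<otimes>\<^bsub>B\<^esub> b3) (\<alpha> b3 a2 a3))"
    by (rule A.add.split_at_one) (use a3 b in \<open>auto simp: closed psi_zero alpha_zero_left\<close>)
  finally show ?thesis
    using a3 b by (simp add: closed A.add.m_assoc)
qed

lemma r_distr_iff:
  "(\<forall>x \<in> carrier N. \<forall>y \<in> carrier N. \<forall>z \<in> carrier N.
      (x \<oplus>\<^bsub>N\<^esub> y) \<otimes>\<^bsub>N\<^esub> z = x \<otimes>\<^bsub>N\<^esub> z \<oplus>\<^bsub>N\<^esub> y \<otimes>\<^bsub>N\<^esub> z)
    \<longleftrightarrow>
        (\<forall>a3 \<in> carrier A.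
         \<forall>b1 \<in> carrier B. \<forall>b2 \<in> carrier B. \<forall>b3 \<in> carrier B.
          \<alpha> b3 (br b1 b2) a3
            \<oplus>\<^bsub>A\<^esub> \<beta> (b1 \<oplus>\<^bsub>B\<^esub> b2) b3 a3 \<oplus>\<^bsub>A\<^esub> ang (b1 \<oplus>\<^bsub>B\<^esub> b2) b3
          = \<beta> b1 b3 a3 \<oplus>\<^bsub>A\<^esub> ang b1 b3
            \<oplus>\<^bsub>A\<^esub> \<psi> (b1 \<otimes>\<^bsub>B\<^esub> b3) (\<beta> b2 b3 a3) \<oplus>\<^bsub>A\<^esub> \<psi> (b1 \<otimes>\<^bsub>B\<^esub> b3) (ang b2 b3)
            \<oplus>\<^bsub>A\<^esub> br (b1 \<otimes>\<^bsub>B\<^esub> b3) (b2 \<otimes>\<^bsub>B\<^esub> b3))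
      \<and> (\<forall>a2 \<in> carrier A. \<forall>a3 \<in> carrier A.
         \<forall>b1 \<in> carrier B. \<forall>b3 \<in> carrier B.
          \<alpha> b3 (\<psi> b1 a2) a3 \<oplus>\<^bsub>A\<^esub> \<beta> b1 b3 a3 \<oplus>\<^bsub>A\<^esub> ang b1 b3
          = \<beta> b1 b3 a3 \<oplus>\<^bsub>A\<^esub> ang b1 b3 \<oplus>\<^bsub>A\<^esub> \<psi> (b1 \<otimes>\<^bsub>B\<^esub> b3) (\<alpha> b3 a2 a3))"
  (is "?L \<longleftrightarrow> ?R")
proof -
  have "?L \<longleftrightarrow> (\<forall>b1 \<in> carrier B. \<forall>b2 \<in> carrier B. \<forall>b3 \<in> carrier B.
      \<forall>a3 \<in> carrier A. \<forall>a1 \<in> carrier A. \<forall>a2 \<in> carrier A.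
      ((a1, b1) \<oplus>\<^bsub>N\<^esub> (a2, b2)) \<otimes>\<^bsub>N\<^esub> (a3, b3) = (a1, b1) \<otimes>\<^bsub>N\<^esub> (a3, b3) \<oplus>\<^bsub>N\<^esub> (a2, b2) \<otimes>\<^bsub>N\<^esub> (a3, b3))"
    unfolding carrier_box by blast
  also have "\<dots> \<longleftrightarrow> ?R"
    using carrier_B_nonempty by (simp add: r_distr_at_iff ball_conj_distrib del: o_apply) blast
  finally show ?thesis .
qed

lemma nearring_box_iff:
  "nearring N \<longleftrightarrow>
      (\<forall>x \<in> carrier N. \<forall>y \<in> carrier N. \<forall>z \<in> carrier N.
        (x \<oplus>\<^bsub>N\<^esub> y) \<oplus>\<^bsub>N\<^esub> z = x \<oplus>\<^bsub>N\<^esub> (y \<oplus>\<^bsub>N\<^esub> z))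
    \<and> (\<forall>x \<in> carrier N. \<forall>y \<in> carrier N. \<forall>z \<in> carrier N.
        (x \<otimes>\<^bsub>N\<^esub> y) \<otimes>\<^bsub>N\<^esub> z = x \<otimes>\<^bsub>N\<^esub> (y \<otimes>\<^bsub>N\<^esub> z))
    \<and> (\<forall>x \<in> carrier N. \<forall>y \<in> carrier N. \<forall>z \<in> carrier N.
        (x \<oplus>\<^bsub>N\<^esub> y) \<otimes>\<^bsub>N\<^esub> z = x \<otimes>\<^bsub>N\<^esub> z \<oplus>\<^bsub>N\<^esub> y \<otimes>\<^bsub>N\<^esub> z)"
  unfolding nearring_def add_group_iff using mult_box_closed by blast


section \<open>The extension\<close>

context
  assumes box: "nearring N"
begin

interpretation N: nearring N
  by (rule box)

text \<open>
  Adding on the left the neutral element \<open>(0, 0)\<close> applies \<open>\<psi>\<^sub>0\<close> to the \<open>A\<close>-component.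
\<close>

lemma psi_zero_id:
  assumes "a \<in> carrier A"
  shows "\<psi> \<zero>\<^bsub>B\<^esub> a = a"
proof -
  have "\<zero>\<^bsub>N\<^esub> \<oplus>\<^bsub>N\<^esub> (a, \<zero>\<^bsub>B\<^esub>) = (a, \<zero>\<^bsub>B\<^esub>)"
    using assms by (simp add: carrier_box)
  then show ?thesis
    using assms by (simp add: zero_box add_box br_zero_left closed)
qed

lemma incl_hom: "box_incl B \<in> nearring_hom A N"
  by (auto simp: nearring_hom_def hom_def box_incl_def carrier_box add_box mult_box closed
      psi_zero_id br_zero_left alpha_zero beta_zero_left ang_zero_left B.zero_mult)

lemma proj_hom: "box_proj \<in> nearring_hom N B"
  by (auto simp: nearring_hom_def hom_def box_proj_def carrier_box add_box mult_box)

lemma incl_inj: "inj_on (box_incl B) (carrier A)"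
  by (simp add: inj_on_def box_incl_def)

lemma incl_image: "box_incl B ` carrier A = {(a, \<zero>\<^bsub>B\<^esub>) | a. a \<in> carrier A}"
  by (auto simp: box_incl_def)

lemma incl_isomorphic: "nearring_isomorphic A (N \<lparr>carrier := box_incl B ` carrier A\<rparr>)"
proof -
  have "box_incl B \<in> nearring_hom A (N \<lparr>carrier := box_incl B ` carrier A\<rparr>)"
    using incl_hom by (auto simp: nearring_hom_def hom_def)
  then show ?thesis
    using incl_inj by (auto simp: nearring_isomorphic_def bij_betw_def)
qed

lemma proj_surj: "box_proj ` carrier N = carrier B"
  using A.add.one_closed by (force simp: box_proj_def carrier_box)

lemma proj_kernel: "a_kernel N B box_proj = {(a, \<zero>\<^bsub>B\<^esub>) | a. a \<in> carrier A}"
  by (auto simp: a_kernel_def' carrier_box box_proj_def)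

lemma incl_image_ideal: "nearring_ideal {(a, \<zero>\<^bsub>B\<^esub>) | a. a \<in> carrier A} N"
  using nearring_hom_kernel_ideal[OF box B.nearring_axioms proj_hom] by (simp add: proj_kernel)

lemma box_extension: "nearring_extension A B N (box_incl B) box_proj"
  using box incl_hom incl_inj incl_image_ideal proj_hom proj_surj proj_kernel
  by (simp add: nearring_extension_def incl_image)

end

end


section \<open>Extensions determined by quintuples\<close>

theorem theorem2p3:
  fixes A :: "('a, 'm) ring_scheme" and B :: "('b, 'n) ring_scheme"
    and \<psi> :: "'b \<Rightarrow> 'a \<Rightarrow> 'a" and br :: "'b \<Rightarrow> 'b \<Rightarrow> 'a"
    and \<alpha> :: "'b \<Rightarrow> 'a \<Rightarrow> 'a \<Rightarrow> 'a" and \<beta> :: "'b \<Rightarrow> 'b \<Rightarrow> 'a \<Rightarrow> 'a"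
    and ang :: "'b \<Rightarrow> 'b \<Rightarrow> 'a"
  assumes "nearring A" and "nearring B"
    and "extension_quintuple A B \<psi> br \<alpha> \<beta> ang"
  shows
    "(nearring (box_product A B \<psi> br \<alpha> \<beta> ang) \<longleftrightarrow>
        (\<forall>b1 \<in> carrier B. \<forall>b2 \<in> carrier B. \<forall>b3 \<in> carrier B.
          br b1 b2 \<oplus>\<^bsub>A\<^esub> br (b1 \<oplus>\<^bsub>B\<^esub> b2) b3
          = \<psi> b1 (br b2 b3) \<oplus>\<^bsub>A\<^esub> br b1 (b2 \<oplus>\<^bsub>B\<^esub> b3))
      \<and> (\<forall>b1 \<in> carrier B. \<forall>b2 \<in> carrier B. \<forall>a \<in> carrier A.
          (\<psi> b1 \<circ> \<psi> b2) a = (inner_map A (br b1 b2) \<circ> \<psi> (b1 \<oplus>\<^bsub>B\<^esub> b2)) a)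
      \<and> (\<forall>a2 \<in> carrier A. \<forall>a3 \<in> carrier A.
         \<forall>b1 \<in> carrier B. \<forall>b2 \<in> carrier B. \<forall>b3 \<in> carrier B.
          \<alpha> b3 (\<beta> b1 b2 a2 \<oplus>\<^bsub>A\<^esub> ang b1 b2) a3
            \<oplus>\<^bsub>A\<^esub> \<beta> (b1 \<otimes>\<^bsub>B\<^esub> b2) b3 a3 \<oplus>\<^bsub>A\<^esub> ang (b1 \<otimes>\<^bsub>B\<^esub> b2) b3
          = \<beta> b1 (b2 \<otimes>\<^bsub>B\<^esub> b3) (\<alpha> b3 a2 a3 \<oplus>\<^bsub>A\<^esub> \<beta> b2 b3 a3 \<oplus>\<^bsub>A\<^esub> ang b2 b3)
            \<oplus>\<^bsub>A\<^esub> ang b1 (b2 \<otimes>\<^bsub>B\<^esub> b3))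
      \<and> (\<forall>a1 \<in> carrier A. \<forall>a2 \<in> carrier A. \<forall>a3 \<in> carrier A.
         \<forall>b2 \<in> carrier B. \<forall>b3 \<in> carrier B.
          \<alpha> b3 (\<alpha> b2 a1 a2) a3
          = \<alpha> (b2 \<otimes>\<^bsub>B\<^esub> b3) a1 (\<alpha> b3 a2 a3 \<oplus>\<^bsub>A\<^esub> \<beta> b2 b3 a3 \<oplus>\<^bsub>A\<^esub> ang b2 b3))
      \<and> (\<forall>a3 \<in> carrier A.
         \<forall>b1 \<in> carrier B. \<forall>b2 \<in> carrier B. \<forall>b3 \<in> carrier B.
          \<alpha> b3 (br b1 b2) a3
            \<oplus>\<^bsub>A\<^esub> \<beta> (b1 \<oplus>\<^bsub>B\<^esub> b2) b3 a3 \<oplus>\<^bsub>A\<^esub> ang (b1 \<oplus>\<^bsub>B\<^esub> b2) b3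
          = \<beta> b1 b3 a3 \<oplus>\<^bsub>A\<^esub> ang b1 b3
            \<oplus>\<^bsub>A\<^esub> \<psi> (b1 \<otimes>\<^bsub>B\<^esub> b3) (\<beta> b2 b3 a3) \<oplus>\<^bsub>A\<^esub> \<psi> (b1 \<otimes>\<^bsub>B\<^esub> b3) (ang b2 b3)
            \<oplus>\<^bsub>A\<^esub> br (b1 \<otimes>\<^bsub>B\<^esub> b3) (b2 \<otimes>\<^bsub>B\<^esub> b3))
      \<and> (\<forall>a2 \<in> carrier A. \<forall>a3 \<in> carrier A.
         \<forall>b1 \<in> carrier B. \<forall>b3 \<in> carrier B.
          \<alpha> b3 (\<psi> b1 a2) a3 \<oplus>\<^bsub>A\<^esub> \<beta> b1 b3 a3 \<oplus>\<^bsub>A\<^esub> ang b1 b3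
          = \<beta> b1 b3 a3 \<oplus>\<^bsub>A\<^esub> ang b1 b3 \<oplus>\<^bsub>A\<^esub> \<psi> (b1 \<otimes>\<^bsub>B\<^esub> b3) (\<alpha> b3 a2 a3)))
   \<and> (nearring (box_product A B \<psi> br \<alpha> \<beta> ang) \<longrightarrow>
        box_incl B \<in> nearring_hom A (box_product A B \<psi> br \<alpha> \<beta> ang)
      \<and> inj_on (box_incl B) (carrier A)
      \<and> box_incl B ` carrier A = {(a, \<zero>\<^bsub>B\<^esub>) | a. a \<in> carrier A}
      \<and> nearring_isomorphic A
          ((box_product A B \<psi> br \<alpha> \<beta> ang) \<lparr>carrier := box_incl B ` carrier A\<rparr>)
      \<and> nearring_ideal {(a, \<zero>\<^bsub>B\<^esub>) | a. a \<in> carrier A} (box_product A B \<psi> br \<alpha> \<beta> ang)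
      \<and> box_proj \<in> nearring_hom (box_product A B \<psi> br \<alpha> \<beta> ang) B
      \<and> box_proj ` carrier (box_product A B \<psi> br \<alpha> \<beta> ang) = carrier B
      \<and> a_kernel (box_product A B \<psi> br \<alpha> \<beta> ang) B box_proj = {(a, \<zero>\<^bsub>B\<^esub>) | a. a \<in> carrier A}
      \<and> nearring_extension A B (box_product A B \<psi> br \<alpha> \<beta> ang) (box_incl B) box_proj)"
proof -
  interpret box_data A B \<psi> br \<alpha> \<beta> ang
    using assms by (simp add: box_data_def)
  show ?thesis
  proof (rule conjI, goal_cases)
    case 1
    show ?case
      unfolding nearring_box_iff add_assoc_iff mult_assoc_iff r_distr_iff conj_assoc by (rule refl)
  next
    case 2
    then show ?case
      using incl_hom incl_inj incl_image incl_isomorphic incl_image_ideal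
        proj_hom proj_surj proj_kernel box_extension
      by simp
  qed
qed

end
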